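(* Let $\mathbb K$ be an algebraically closed field of characteristic zero. Let $I\subseteq R=\mathbb K[x_1,\dots,x_n]$ be a zero-dimensional ideal such that $R/I$ has length $r$. Pick $n$ general elements of $R/I$ and preimages $v_1,\dots,v_n\in R$ of them. Then there exists a squat ideal $I_0\subseteq\mathbb K[x_1,\dots,x_n]$ such that (the classes of the elements of) the set $$\{\,v_1^{e_1}\cdots v_n^{e_n}\ |\ (e_1,\dots,e_n)\in E_{I_0}\,\}$$ form a $\mathbb K$-basis of $R/I$.
   Context: A monomial ideal $J\subseteq \mathbb K[x_1,\dots,x_n]$ of finite colength is Borel-fixed if for every $i\ge j$ and every monomial $x_im'\in J$ we have $x_jm'\in J$. A zero-dimensional Borel-fixed ideal $J$ is a squat ideal if for every $i$ and every monomial $x_im'\in J$ we have $(x_1,\dots,x_n)^2m'\subset J$. For a squat ideal $J$, its squat staircase $E_J\subseteq\mathbb N^n$ is the set of exponents of all monomials not in $J$. "General" means: there is a nonempty Zariski open subset $U$ of the affine space $(R/I)^n$ such that the assertion holds for every $(\bar v_1,\dots,\bar v_n)\in U$. The basis is indexed by $E_{I_0}$ (i.e. the elements $v^e$, $e\in E_{I_0}$, are pairwise distinct in $R/I$ and form a basis). *)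

theory Defs
  imports
    "HOL-Library.Poly_Mapping"
    "HOL-Computational_Algebra.Polynomial"
begin

text \<open>
  The variables are indexed by a finite linearly ordered type \<open>'n\<close> (in place of
  \<open>{1..n}\<close>); a monomial is represented by its exponent vector.
\<close>

type_synonym ('n, 'k) mpoly = "('n \<Rightarrow>\<^sub>0 nat) \<Rightarrow>\<^sub>0 'k"

abbreviation mono_of :: "('n \<Rightarrow>\<^sub>0 nat) \<Rightarrow> ('n, 'k::comm_ring_1) mpoly" where
  "mono_of e \<equiv> Poly_Mapping.single e 1"

abbreviation Var :: "'n \<Rightarrow> ('n, 'k::comm_ring_1) mpoly" where
  "Var i \<equiv> mono_of (Poly_Mapping.single i 1)"

abbreviation Const :: "'k \<Rightarrow> ('n, 'k::comm_ring_1) mpoly" where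
  "Const c \<equiv> Poly_Mapping.single 0 c"

text \<open>Ideals are the submodules of the ring regarded as a module over itself.\<close>

lemma module_mult: "module ((*) :: 'a::comm_ring_1 \<Rightarrow> 'a \<Rightarrow> 'a)"
  by unfold_locales (auto simp: algebra_simps)

abbreviation is_ideal :: "'a::comm_ring_1 set \<Rightarrow> bool" where
  "is_ideal \<equiv> module.subspace (*)"

abbreviation ideal_gen :: "'a::comm_ring_1 set \<Rightarrow> 'a set" where
  "ideal_gen \<equiv> module.span (*)"

definition residue_class :: "'a::comm_ring_1 set \<Rightarrow> 'a \<Rightarrow> 'a set" where
  "residue_class I f = {g. g - f \<in> I}"

definition residue_ring :: "'a::comm_ring_1 set \<Rightarrow> 'a set set" where
  "residue_ring I = range (residue_class I)"

text \<open>
  \<open>quotient_basis I E b\<close>: the classes of the family \<open>b e\<close>, indexed by \<open>e \<in> E\<close>, form a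
  (finite) basis of the vector space \<open>R/I\<close>. As the family is indexed, its members are
  then pairwise distinct modulo \<open>I\<close>.
\<close>

definition quotient_basis ::
    "('n, 'k::field) mpoly set \<Rightarrow> 'i set \<Rightarrow> ('i \<Rightarrow> ('n, 'k) mpoly) \<Rightarrow> bool" where
  "quotient_basis I E b \<longleftrightarrow>
     finite E \<and>
     (\<forall>c. (\<Sum>e\<in>E. Const (c e) * b e) \<in> I \<longrightarrow> (\<forall>e\<in>E. c e = 0)) \<and>
     (\<forall>f. \<exists>c. f - (\<Sum>e\<in>E. Const (c e) * b e) \<in> I)"

text \<open>The length of \<open>R/I\<close> is its dimension over the ground field.\<close>

definition has_colength :: "('n, 'k::field) mpoly set \<Rightarrow> nat \<Rightarrow> bool" where
  "has_colength I r \<longleftrightarrow> (\<exists>b. quotient_basis I {..<r} b)"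

definition zero_dimensional :: "('n, 'k::field) mpoly set \<Rightarrow> bool" where
  "zero_dimensional I \<longleftrightarrow> is_ideal I \<and> (\<exists>r. has_colength I r)"

definition monomial_ideal :: "('n, 'k::field) mpoly set \<Rightarrow> bool" where
  "monomial_ideal J \<longleftrightarrow> (\<exists>S. J = ideal_gen (mono_of ` S))"

definition borel_fixed :: "('n::linorder, 'k::field) mpoly set \<Rightarrow> bool" where
  "borel_fixed J \<longleftrightarrow>
     monomial_ideal J \<and> zero_dimensional J \<and>
     (\<forall>i j m. j \<le> i \<longrightarrow> Var i * mono_of m \<in> J \<longrightarrow> Var j * mono_of m \<in> J)"

definition vars_ideal :: "('n, 'k::field) mpoly set" where
  "vars_ideal = ideal_gen (range Var)"

definition vars_ideal_sq :: "('n, 'k::field) mpoly set" where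
  "vars_ideal_sq = ideal_gen {p * q | p q. p \<in> vars_ideal \<and> q \<in> vars_ideal}"

definition squat_ideal :: "('n::linorder, 'k::field) mpoly set \<Rightarrow> bool" where
  "squat_ideal J \<longleftrightarrow>
     borel_fixed J \<and>
     (\<forall>i m. Var i * mono_of m \<in> J \<longrightarrow> (\<forall>p\<in>vars_ideal_sq. p * mono_of m \<in> J))"

definition squat_staircase :: "('n, 'k::field) mpoly set \<Rightarrow> ('n \<Rightarrow>\<^sub>0 nat) set" where
  "squat_staircase J = {e. mono_of e \<notin> J}"

text \<open>
  The affine space \<open>(R/I)\<^sup>n\<close> with its Zariski topology. Its regular functions
  are the elements of the algebra generated by the linear functionals on the factors
  \<open>R/I\<close>; for finite-dimensional \<open>R/I\<close> these are the polynomials in the coordinates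
  with respect to any basis. Only their values on \<open>affine_pts I\<close> matter.
\<close>

definition affine_pts :: "('n, 'k::field) mpoly set \<Rightarrow> ('n \<Rightarrow> ('n, 'k) mpoly set) set" where
  "affine_pts I = {w. \<forall>i. w i \<in> residue_ring I}"

definition linear_functional ::
    "('n, 'k::field) mpoly set \<Rightarrow> (('n, 'k) mpoly set \<Rightarrow> 'k) \<Rightarrow> bool" where
  "linear_functional I l \<longleftrightarrow>
     (\<forall>f g. l (residue_class I (f + g)) = l (residue_class I f) + l (residue_class I g)) \<and>
     (\<forall>c f. l (residue_class I (Const c * f)) = c * l (residue_class I f))"

inductive_set regular_functions ::
    "('n, 'k::field) mpoly set \<Rightarrow> (('n \<Rightarrow> ('n, 'k) mpoly set) \<Rightarrow> 'k) set"
  for I :: "('n, 'k) mpoly set" where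
  const: "(\<lambda>_. c) \<in> regular_functions I"
| linear: "linear_functional I l \<Longrightarrow> (\<lambda>w. l (w i)) \<in> regular_functions I"
| add: "f \<in> regular_functions I \<Longrightarrow> g \<in> regular_functions I \<Longrightarrow>
    (\<lambda>w. f w + g w) \<in> regular_functions I"
| mult: "f \<in> regular_functions I \<Longrightarrow> g \<in> regular_functions I \<Longrightarrow>
    (\<lambda>w. f w * g w) \<in> regular_functions I"

definition zariski_closed ::
    "('n, 'k::field) mpoly set \<Rightarrow> ('n \<Rightarrow> ('n, 'k) mpoly set) set \<Rightarrow> bool" where
  "zariski_closed I Z \<longleftrightarrow>
     (\<exists>F \<subseteq> regular_functions I. Z = {w \<in> affine_pts I. \<forall>f\<in>F. f w = 0})"

definition zariski_open ::
    "('n, 'k::field) mpoly set \<Rightarrow> ('n \<Rightarrow> ('n, 'k) mpoly set) set \<Rightarrow> bool" where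
  "zariski_open I U \<longleftrightarrow> U \<subseteq> affine_pts I \<and> zariski_closed I (affine_pts I - U)"

end

theory Submission
  imports Defs "Jordan_Normal_Form.Determinant"
begin

text \<open>
  Let \<open>A = R/I\<close>. For a point \<open>v\<close> of \<open>A\<^sup>n\<close> and a set \<open>E\<close> of exponents of size \<open>dim A\<close>, that
  the monomials \<open>v^e\<close> with \<open>e \<in> E\<close> form a basis of \<open>A\<close> means that a determinant,
  which is a regular function of \<open>v\<close>, does not vanish. So the theorem asks for one squat
  staircase \<open>E\<close> whose determinant is nonzero at one point; the open set is its nonvanishing locus.

  Order the monomials by degree and then lexicographically with \<open>x_1\<close> the largest variable, and
  choose \<open>E\<close> together with a point \<open>v\<close> so that it gives a basis and the sum of the positions
  of its members in this order is the least possible. Such pairs exist since the variables generate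
  \<open>A\<close> (\<open>exists_monomial_quotient_basis\<close>). This \<open>E\<close> is the set of standard monomials of a
  generic initial ideal, with minimality in the place of genericity. By exchange, every \<open>v^e\<close> is a combination of
  basis monomials not above \<open>e\<close> (\<open>rank_le_if_coord_nonzero\<close>), so the complement of \<open>E\<close> is
  closed under multiplication (\<open>staircase_complement_up\<close>).

  The Borel and the squat condition come from a single first-order deformation. The relation that
  expresses \<open>v^e\<close>, for \<open>e = x_i m\<close> outside \<open>E\<close>, through smaller basis monomials persists
  when \<open>v_i\<close> is moved in the direction \<open>v^p\<close>, because by minimality larger monomials
  cannot enter it. Its derivative expresses \<open>v^{p m}\<close>, up to a positive integer factor,
  through smaller monomials as soon as \<open>p\<close> is above \<open>x_i\<close> (\<open>staircase_complement_step\<close>). With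
  \<open>p = x_j\<close>, \<open>j < i\<close>, this is the Borel condition; with \<open>p = x_j x_k\<close>, which exceeds every
  variable because the order compares degrees first, it is the squat condition.
\<close>

section \<open>Coordinates in a quotient of finite dimension\<close>

lemmas ideal_zero = Modules.module.subspace_0[OF module_mult]
lemmas ideal_add = Modules.module.subspace_add[OF module_mult]
lemmas ideal_diff = Modules.module.subspace_diff[OF module_mult]
lemmas ideal_mult = Modules.module.subspace_scale[OF module_mult]
lemmas ideal_sum = Modules.module.subspace_sum[OF module_mult]

lemma Const_mult: "Const (a * b) = Const a * Const b"
  by (simp add: mult_single)

lemma residue_class_eq_iff:
  assumes "is_ideal I"
  shows "residue_class I f = residue_class I g \<longleftrightarrow> f - g \<in> I"
proof
  assume "residue_class I f = residue_class I g"
  moreover have "f \<in> residue_class I f"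
    using ideal_zero[OF assms] by (simp add: residue_class_def)
  ultimately show "f - g \<in> I" by (simp add: residue_class_def)
next
  assume d: "f - g \<in> I"
  have "x - f \<in> I \<longleftrightarrow> x - g \<in> I" for x
    using ideal_add[OF assms, of "x - f" "f - g"] ideal_diff[OF assms, of "x - g" "f - g"] d by auto
  then show "residue_class I f = residue_class I g" by (simp add: residue_class_def)
qed

lemma quotient_basis_independent:
  assumes "quotient_basis I E b" "(\<Sum>e\<in>E. Const (c e) * b e) \<in> I" "e \<in> E"
  shows "c e = 0"
proof -
  have "\<forall>c. (\<Sum>e\<in>E. Const (c e) * b e) \<in> I \<longrightarrow> (\<forall>e\<in>E. c e = 0)"
    using assms(1) by (simp add: quotient_basis_def)
  from this[rule_format, OF assms(2,3)] show ?thesis .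
qed

lemma quotient_basis_spanning:
  assumes "quotient_basis I E b"
  shows "\<exists>c. f - (\<Sum>e\<in>E. Const (c e) * b e) \<in> I"
  using assms unfolding quotient_basis_def by (elim conjE) (rule spec)

text \<open>
  Coordinates modulo \<open>I\<close> with respect to a basis \<open>b\<close> of the quotient. They are taken on
  polynomials rather than on residue classes, so that the quotient algebra never has to be
  a type of its own; only the entries below \<open>s\<close> are meaningful.
\<close>

definition coord ::
    "('n, 'k::field) mpoly set \<Rightarrow> nat \<Rightarrow> (nat \<Rightarrow> ('n, 'k) mpoly) \<Rightarrow> ('n, 'k) mpoly \<Rightarrow> nat \<Rightarrow> 'k" where
  "coord I s b f = (SOME c. f - (\<Sum>k<s. Const (c k) * b k) \<in> I)"

locale quotient_coordinates =
  fixes I :: "('n, 'k::field) mpoly set" and s :: nat and b :: "nat \<Rightarrow> ('n, 'k) mpoly"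
  assumes ideal: "is_ideal I" and basis: "quotient_basis I {..<s} b"
begin

lemma coord_spec: "f - (\<Sum>k<s. Const (coord I s b f k) * b k) \<in> I"
  unfolding coord_def by (rule someI_ex[OF quotient_basis_spanning[OF basis]])

lemma coord_eqI:
  assumes "f - (\<Sum>k<s. Const (c k) * b k) \<in> I" "k < s"
  shows "coord I s b f k = c k"
proof -
  let ?d = "\<lambda>k. coord I s b f k - c k"
  have "(f - (\<Sum>k<s. Const (c k) * b k)) - (f - (\<Sum>k<s. Const (coord I s b f k) * b k)) \<in> I"
    by (rule ideal_diff[OF ideal assms(1) coord_spec])
  also have "(f - (\<Sum>k<s. Const (c k) * b k)) - (f - (\<Sum>k<s. Const (coord I s b f k) * b k))
      = (\<Sum>k<s. Const (?d k) * b k)"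
    by (simp add: single_diff left_diff_distrib sum_subtractf)
  finally have "?d k = 0"
    by (rule quotient_basis_independent[OF basis]) (use assms(2) in simp)
  then show ?thesis by simp
qed

lemma coord_add:
  assumes "k < s"
  shows "coord I s b (f + g) k = coord I s b f k + coord I s b g k"
proof (rule coord_eqI[OF _ assms])
  show "f + g - (\<Sum>k<s. Const (coord I s b f k + coord I s b g k) * b k) \<in> I"
    using ideal_add[OF ideal coord_spec[of f] coord_spec[of g]]
    by (simp add: single_add distrib_right sum.distrib add_diff_add)
qed

lemma coord_scale:
  assumes "k < s"
  shows "coord I s b (Const a * f) k = a * coord I s b f k"
proof (rule coord_eqI[OF _ assms])
  show "Const a * f - (\<Sum>k<s. Const (a * coord I s b f k) * b k) \<in> I"
    using ideal_mult[OF ideal coord_spec[of f], of "Const a"]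
    by (simp add: Const_mult right_diff_distrib sum_distrib_left mult.assoc)
qed

lemma coord_in_ideal: "f \<in> I \<Longrightarrow> k < s \<Longrightarrow> coord I s b f k = 0"
  by (rule coord_eqI) auto

lemma coord_zero: "k < s \<Longrightarrow> coord I s b 0 k = 0"
  by (rule coord_in_ideal[OF ideal_zero[OF ideal]])

lemma coord_sum:
  assumes "k < s"
  shows "coord I s b (sum F A) k = (\<Sum>x\<in>A. coord I s b (F x) k)"
  by (induction A rule: infinite_finite_induct) (auto simp: coord_add coord_zero assms)

lemma coord_cong:
  assumes "f - g \<in> I" "k < s"
  shows "coord I s b f k = coord I s b g k"
  using coord_add[OF assms(2), of "f - g" g] coord_in_ideal[OF assms] by simp

lemma coord_basis: "j < s \<Longrightarrow> k < s \<Longrightarrow> coord I s b (b j) k = (if k = j then 1 else 0)"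
proof (rule coord_eqI)
  assume "j < s"
  have "(\<Sum>k<s. Const (if k = j then 1 else 0) * b k) = (\<Sum>k<s. if k = j then b k else 0)"
    by (intro sum.cong) auto
  also have "\<dots> = b j" using \<open>j < s\<close> by simp
  finally show "b j - (\<Sum>k<s. Const (if k = j then 1 else 0) * b k) \<in> I"
    by (simp add: ideal_zero[OF ideal])
qed

lemma in_ideal_iff_coord: "f \<in> I \<longleftrightarrow> (\<forall>k<s. coord I s b f k = 0)"
proof
  assume "\<forall>k<s. coord I s b f k = 0"
  then have "(\<Sum>k<s. Const (coord I s b f k) * b k) = 0" by (intro sum.neutral) auto
  then show "f \<in> I" using coord_spec[of f] by simp
qed (auto simp: coord_in_ideal)

text \<open>
  Multiplication by \<open>g\<close> is an endomorphism of the quotient, so it is determined by its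
  values on the basis.
\<close>

lemma coord_mult:
  assumes "k < s"
  shows "coord I s b (f * g) k = (\<Sum>j<s. coord I s b f j * coord I s b (b j * g) k)"
proof -
  have "f * g - (\<Sum>j<s. Const (coord I s b f j) * b j) * g \<in> I"
    using ideal_mult[OF ideal coord_spec[of f], of g]
    by (simp add: right_diff_distrib mult.commute)
  then have "coord I s b (f * g) k = coord I s b ((\<Sum>j<s. Const (coord I s b f j) * b j) * g) k"
    by (rule coord_cong[OF _ assms])
  also have "\<dots> = coord I s b (\<Sum>j<s. Const (coord I s b f j) * (b j * g)) k"
    by (simp add: sum_distrib_right mult.assoc)
  finally show ?thesis by (simp add: coord_sum coord_scale assms)
qed

definition coord_mat :: "(nat \<Rightarrow> ('n, 'k) mpoly) \<Rightarrow> 'k mat" where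
  "coord_mat g = mat s s (\<lambda>(k, j). coord I s b (g j) k)"

lemma coord_mat_carrier [simp]: "coord_mat g \<in> carrier_mat s s"
  by (simp add: coord_mat_def)

lemma coord_mat_mult_vec:
  assumes "k < s"
  shows "(coord_mat g *\<^sub>v vec s c) $ k = coord I s b (\<Sum>j<s. Const (c j) * g j) k"
  using assms
  by (simp add: coord_mat_def scalar_prod_def coord_sum coord_scale atLeast0LessThan
      mult.commute[of "coord _ _ _ _ _"])

text \<open>
  The columns of the square matrix are the coordinate vectors of the family, and a vector in its
  kernel is a linear relation modulo \<open>I\<close>.
\<close>

lemma det_coord_mat_nonzero_iff_independent:
  "det (coord_mat g) \<noteq> 0 \<longleftrightarrow>
     (\<forall>c. (\<Sum>j<s. Const (c j) * g j) \<in> I \<longrightarrow> (\<forall>j<s. c j = 0))"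
proof -
  have "det (coord_mat g) = 0 \<longleftrightarrow> (\<exists>v. v \<in> carrier_vec s \<and> v \<noteq> 0\<^sub>v s \<and> coord_mat g *\<^sub>v v = 0\<^sub>v s)"
    by (rule det_0_iff_vec_prod_zero[OF coord_mat_carrier])
  also have "\<dots> \<longleftrightarrow> (\<exists>c. vec s c \<noteq> 0\<^sub>v s \<and> coord_mat g *\<^sub>v vec s c = 0\<^sub>v s)"
  proof (intro iffI; elim exE conjE)
    fix v assume "v \<in> carrier_vec s" "v \<noteq> 0\<^sub>v s" "coord_mat g *\<^sub>v v = 0\<^sub>v s"
    moreover from this have "vec s (\<lambda>j. v $ j) = v" by auto
    ultimately show "\<exists>c. vec s c \<noteq> 0\<^sub>v s \<and> coord_mat g *\<^sub>v vec s c = 0\<^sub>v s"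
      by (intro exI[of _ "\<lambda>j. v $ j"]) simp
  next
    fix c assume "vec s c \<noteq> 0\<^sub>v s" "coord_mat g *\<^sub>v vec s c = 0\<^sub>v s"
    then show "\<exists>v. v \<in> carrier_vec s \<and> v \<noteq> 0\<^sub>v s \<and> coord_mat g *\<^sub>v v = 0\<^sub>v s"
      by (intro exI[of _ "vec s c"]) simp
  qed
  also have "\<dots> \<longleftrightarrow> (\<exists>c. (\<exists>j<s. c j \<noteq> 0) \<and> (\<Sum>j<s. Const (c j) * g j) \<in> I)"
  proof -
    have "vec s c = 0\<^sub>v s \<longleftrightarrow> (\<forall>j<s. c j = 0)" for c :: "nat \<Rightarrow> 'k"
      by (auto simp: vec_eq_iff)
    moreover have "coord_mat g *\<^sub>v vec s c = 0\<^sub>v s \<longleftrightarrow> (\<Sum>j<s. Const (c j) * g j) \<in> I" for c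
      using coord_mat_mult_vec[of _ g c] carrier_matD[OF coord_mat_carrier[of g]]
      by (auto simp: vec_eq_iff in_ideal_iff_coord simp del: index_mult_mat_vec)
    ultimately show ?thesis by auto
  qed
  finally show ?thesis by blast
qed

lemma quotient_basis_iff_det_nonzero:
  "quotient_basis I {..<s} g \<longleftrightarrow> det (coord_mat g) \<noteq> 0"
proof
  assume "quotient_basis I {..<s} g"
  then show "det (coord_mat g) \<noteq> 0"
    unfolding det_coord_mat_nonzero_iff_independent by (simp add: quotient_basis_def)
next
  assume det: "det (coord_mat g) \<noteq> 0"
  have "\<exists>c. f - (\<Sum>j<s. Const (c j) * g j) \<in> I" for f
  proof -
    obtain B where B: "B \<in> carrier_mat s s" "coord_mat g * B = 1\<^sub>m s"
      using det_non_zero_imp_unit[OF coord_mat_carrier det, of "()"]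
      by (auto simp: Units_def ring_mat_def)
    define x where "x = B *\<^sub>v vec s (coord I s b f)"
    have x: "x \<in> carrier_vec s" using B(1) by (simp add: x_def)
    have "coord_mat g *\<^sub>v x = vec s (coord I s b f)"
      unfolding x_def
      by (subst assoc_mult_mat_vec[symmetric, OF coord_mat_carrier B(1)]) (auto simp: B(2))
    moreover have "x = vec s (\<lambda>j. x $ j)" using x by auto
    ultimately have "coord I s b (\<Sum>j<s. Const (x $ j) * g j) k = coord I s b f k" if "k < s" for k
      using coord_mat_mult_vec[OF that, of g "\<lambda>j. x $ j"] that by simp
    then have "f - (\<Sum>j<s. Const (x $ j) * g j) \<in> I"
      unfolding in_ideal_iff_coord
      using coord_add[of _ "f - (\<Sum>j<s. Const (x $ j) * g j)" "\<Sum>j<s. Const (x $ j) * g j"]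
      by (auto simp: algebra_simps)
    then show ?thesis by (rule exI[where x = "\<lambda>j. x $ j"])
  qed
  then show "quotient_basis I {..<s} g"
    using det unfolding det_coord_mat_nonzero_iff_independent by (simp add: quotient_basis_def)
qed

text \<open>
  Steinitz exchange. By counting, independence of the new family is enough; a relation in it
  has vanishing coefficient at \<open>f\<close> because only \<open>f\<close> has an \<open>l\<close>-th coordinate.
\<close>

lemma quotient_basis_exchange:
  assumes "l < s" "coord I s b f l \<noteq> 0"
  shows "quotient_basis I {..<s} (b(l := f))"
  unfolding quotient_basis_iff_det_nonzero det_coord_mat_nonzero_iff_independent
proof (intro allI impI)
  fix c and j :: nat
  assume c: "(\<Sum>j<s. Const (c j) * (b(l := f)) j) \<in> I" and "j < s"
  have eq: "0 = c l * coord I s b f k + (if k = l then 0 else c k)" if "k < s" for k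
  proof -
    have "0 = (\<Sum>j<s. c j * coord I s b ((b(l := f)) j) k)"
      using coord_in_ideal[OF c that] by (simp only: coord_sum[OF that] coord_scale[OF that])
    also have "\<dots> = c l * coord I s b f k + (\<Sum>j\<in>{..<s} - {l}. c j * coord I s b (b j) k)"
      using assms(1) by (subst sum.remove[of _ l]) auto
    also have "(\<Sum>j\<in>{..<s} - {l}. c j * coord I s b (b j) k)
        = (\<Sum>j\<in>{..<s} - {l}. if j = k then c j else 0)"
      using that by (intro sum.cong) (auto simp: coord_basis)
    also have "\<dots> = (if k = l then 0 else c k)" using that by simp
    finally show ?thesis .
  qed
  have "c l = 0" using eq[OF assms(1)] assms(2) by simp
  then show "c j = 0" using eq[OF \<open>j < s\<close>] by (auto split: if_splits)
qed

end

lemma quotient_basis_reindex: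
  assumes "bij_betw h A B"
  shows "quotient_basis I A (\<lambda>a. b (h a)) \<longleftrightarrow> quotient_basis I B b"
proof -
  let ?g = "inv_into A h"
  have inj: "inj_on h A" and B: "B = h ` A" using assms by (auto simp: bij_betw_def)
  have push: "(\<Sum>a\<in>A. Const (c (h a)) * b (h a)) = (\<Sum>e\<in>B. Const (c e) * b e)" for c
    by (rule sum.reindex_bij_betw[OF assms])
  have pull: "(\<Sum>a\<in>A. Const (c a) * b (h a)) = (\<Sum>e\<in>B. Const (c (?g e)) * b e)" for c
    unfolding push[symmetric] by (intro sum.cong) (auto simp: inv_into_f_f[OF inj])
  have zero_push: "(\<forall>a\<in>A. c (h a) = 0) \<longleftrightarrow> (\<forall>e\<in>B. c e = 0)" for c :: "_ \<Rightarrow> 'd"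
    by (auto simp: B)
  have zero_pull: "(\<forall>e\<in>B. c (?g e) = 0) \<longleftrightarrow> (\<forall>a\<in>A. c a = 0)" for c :: "_ \<Rightarrow> 'd"
    by (auto simp: B inv_into_f_f[OF inj])
  show ?thesis
  proof
    assume A: "quotient_basis I A (\<lambda>a. b (h a))"
    show "quotient_basis I B b"
      unfolding quotient_basis_def
    proof (intro conjI allI impI)
      show "finite B" using A by (simp add: B quotient_basis_def)
      show "\<forall>e\<in>B. c e = 0" if "(\<Sum>e\<in>B. Const (c e) * b e) \<in> I" for c
        using quotient_basis_independent[OF A, of "\<lambda>a. c (h a)"] that
        unfolding push zero_push[symmetric] by blast
      show "\<exists>c. f - (\<Sum>e\<in>B. Const (c e) * b e) \<in> I" for f
      proof -
        obtain c where "f - (\<Sum>a\<in>A. Const (c a) * b (h a)) \<in> I"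
          using quotient_basis_spanning[OF A] by blast
        then show ?thesis unfolding pull by (rule exI[of _ "\<lambda>e. c (?g e)"])
      qed
    qed
  next
    assume BB: "quotient_basis I B b"
    show "quotient_basis I A (\<lambda>a. b (h a))"
      unfolding quotient_basis_def
    proof (intro conjI allI impI)
      show "finite A" using BB finite_imageD[OF _ inj] by (simp add: B quotient_basis_def)
      show "\<forall>a\<in>A. c a = 0" if "(\<Sum>a\<in>A. Const (c a) * b (h a)) \<in> I" for c
        using quotient_basis_independent[OF BB, of "\<lambda>e. c (?g e)"] that
        unfolding pull zero_pull[symmetric] by blast
      show "\<exists>c. f - (\<Sum>a\<in>A. Const (c a) * b (h a)) \<in> I" for f
      proof -
        obtain c where "f - (\<Sum>e\<in>B. Const (c e) * b e) \<in> I"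
          using quotient_basis_spanning[OF BB] by blast
        then show ?thesis unfolding push[symmetric] by (rule exI[of _ "\<lambda>a. c (h a)"])
      qed
    qed
  qed
qed

lemma quotient_basis_inj_on:
  assumes "is_ideal I" "quotient_basis I A b"
  shows "inj_on b A"
proof (rule inj_onI, rule ccontr)
  fix x y assume xy: "x \<in> A" "y \<in> A" "b x = b y" "x \<noteq> y"
  have fin: "finite A" using assms(2) by (simp add: quotient_basis_def)
  define c :: "_ \<Rightarrow> 'b" where "c z = (if z = x then 1 else if z = y then - 1 else 0)" for z
  have "(\<Sum>e\<in>A. Const (c e) * b e) = b x + (Const (- 1) * b y + (\<Sum>e\<in>A - {x} - {y}. Const (c e) * b e))"
    using xy fin by (simp add: sum.remove[of A x] sum.remove[of "A - {x}" y] c_def)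
  also have "(\<Sum>e\<in>A - {x} - {y}. Const (c e) * b e) = 0"
    by (intro sum.neutral) (auto simp: c_def)
  finally have "(\<Sum>e\<in>A. Const (c e) * b e) = 0" using xy(3) by (simp add: single_uminus)
  then have "(\<Sum>e\<in>A. Const (c e) * b e) \<in> I" using ideal_zero[OF assms(1)] by simp
  then have "c x = 0" using quotient_basis_independent[OF assms(2)] xy(1) by blast
  then show False by (simp add: c_def)
qed

section \<open>Monomials and the degree-lexicographic order\<close>

text \<open>
  Evaluation of a monomial. The value ring is left general because the deformation argument
  evaluates monomials at univariate polynomials over the multivariate ring.
\<close>

definition monomial_at :: "('n::finite \<Rightarrow> 'a::comm_monoid_mult) \<Rightarrow> ('n \<Rightarrow>\<^sub>0 nat) \<Rightarrow> 'a" where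
  "monomial_at v e = (\<Prod>i\<in>UNIV. v i ^ Poly_Mapping.lookup e i)"

lemma monomial_at_add: "monomial_at v (e + f) = monomial_at v e * monomial_at v f"
  by (simp add: monomial_at_def lookup_add power_add prod.distrib)

lemma mono_of_prod:
  "(\<Prod>x\<in>A. mono_of (g x)) = (mono_of (\<Sum>x\<in>A. g x) :: ('n, 'k::comm_ring_1) mpoly)"
  by (induction A rule: infinite_finite_induct) (auto simp: mult_single)

lemma Var_power: "(Var i :: ('n, 'k::comm_ring_1) mpoly) ^ k = mono_of (Poly_Mapping.single i k)"
  by (induction k) (auto simp: mult_single single_add[symmetric])

lemma monomial_at_Var: "monomial_at Var e = (mono_of e :: ('n::finite, 'k::comm_ring_1) mpoly)"
proof -
  have "(\<Sum>i\<in>UNIV. Poly_Mapping.single i (Poly_Mapping.lookup e i)) = e"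
    by (rule poly_mapping_eqI) (simp add: lookup_sum lookup_single when_def)
  then show ?thesis by (simp only: monomial_at_def Var_power mono_of_prod)
qed

definition total_degree :: "('n::finite \<Rightarrow>\<^sub>0 nat) \<Rightarrow> nat" where
  "total_degree e = (\<Sum>i\<in>UNIV. Poly_Mapping.lookup e i)"

lemma total_degree_add: "total_degree (e + f) = total_degree e + total_degree f"
  by (simp add: total_degree_def lookup_add sum.distrib)

lemma total_degree_single: "total_degree (Poly_Mapping.single i k) = k"
  by (simp add: total_degree_def lookup_single when_def)

lemma finite_total_degree_le: "finite {e :: 'n::finite \<Rightarrow>\<^sub>0 nat. total_degree e \<le> d}"
proof (rule finite_imageD)
  have "Poly_Mapping.lookup e i \<le> total_degree e" for e :: "'n \<Rightarrow>\<^sub>0 nat" and i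
    unfolding total_degree_def by (rule member_le_sum) auto
  then have "Poly_Mapping.lookup ` {e :: 'n \<Rightarrow>\<^sub>0 nat. total_degree e \<le> d} \<subseteq> PiE UNIV (\<lambda>_. {..d})"
    by (auto simp: PiE_def intro: order_trans)
  then show "finite (Poly_Mapping.lookup ` {e :: 'n \<Rightarrow>\<^sub>0 nat. total_degree e \<le> d})"
    by (rule finite_subset) (auto intro: finite_PiE)
  show "inj_on Poly_Mapping.lookup {e :: 'n \<Rightarrow>\<^sub>0 nat. total_degree e \<le> d}"
    by (auto intro: inj_onI simp: poly_mapping.lookup_inject)
qed

text \<open>
  The order on exponent vectors in \<open>f < e\<close> is lexicographic, and its most significant
  position is the least index: among the variables, \<open>Var j\<close> lies above \<open>Var i\<close> for \<open>j < i\<close>.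
\<close>

definition deglex_less :: "('n::{finite,linorder} \<Rightarrow>\<^sub>0 nat) \<Rightarrow> ('n \<Rightarrow>\<^sub>0 nat) \<Rightarrow> bool" where
  "deglex_less f e \<longleftrightarrow>
     total_degree f < total_degree e \<or> total_degree f = total_degree e \<and> f < e"

text \<open>
  Only finitely many monomials lie below a given one, so the order can be replaced by the
  position in it. Natural numbers allow bases to be compared by the sum of the positions of their
  members, which drops with every exchange for a smaller monomial.
\<close>

definition deglex_rank :: "('n::{finite,linorder} \<Rightarrow>\<^sub>0 nat) \<Rightarrow> nat" where
  "deglex_rank e = card {f. deglex_less f e}"

lemma deglex_rank_less:
  assumes "deglex_less f e"
  shows "deglex_rank f < deglex_rank e"
  unfolding deglex_rank_def
proof (rule psubset_card_mono)
  show "finite {f. deglex_less f e}"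
    by (rule finite_subset[OF _ finite_total_degree_le[of "total_degree e"]])
      (auto simp: deglex_less_def)
  show "{g. deglex_less g f} \<subset> {g. deglex_less g e}"
    using assms by (auto simp: deglex_less_def)
qed

lemma deglex_rank_less_iff: "deglex_rank f < deglex_rank e \<longleftrightarrow> deglex_less f e"
proof
  assume "deglex_rank f < deglex_rank e"
  then have "\<not> deglex_less e f" "f \<noteq> e" using deglex_rank_less by fastforce+
  then show "deglex_less f e" by (auto simp: deglex_less_def)
qed (rule deglex_rank_less)

lemma deglex_rank_eq_iff: "deglex_rank f = deglex_rank e \<longleftrightarrow> f = e"
proof
  assume "deglex_rank f = deglex_rank e"
  then have "\<not> deglex_less e f" "\<not> deglex_less f e" using deglex_rank_less by fastforce+
  then show "f = e" by (auto simp: deglex_less_def)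
qed simp

lemma deglex_rank_add_less_iff: "deglex_rank (f + d) < deglex_rank (e + d) \<longleftrightarrow> deglex_rank f < deglex_rank e"
  by (simp add: deglex_rank_less_iff deglex_less_def total_degree_add)

lemma deglex_rank_Var_less_Var:
  assumes "j < i"
  shows "deglex_rank (Poly_Mapping.single i 1) < deglex_rank (Poly_Mapping.single j 1)"
proof -
  have "Poly_Mapping.single i (1::nat) < Poly_Mapping.single j 1"
    unfolding less_poly_mapping.rep_eq less_fun_def
    using assms by (intro exI[of _ j]) (auto simp: lookup_single when_def)
  then show ?thesis by (simp add: deglex_rank_less_iff deglex_less_def total_degree_single)
qed

lemma deglex_rank_Var_less_quadratic:
  fixes i j k :: "'n::{finite,linorder}"
  shows "deglex_rank (Poly_Mapping.single i 1) < deglex_rank (Poly_Mapping.single j 1 + Poly_Mapping.single k 1)"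
  by (simp add: deglex_rank_less_iff deglex_less_def total_degree_single total_degree_add
      del: One_nat_def)

section \<open>Monomial ideals\<close>

lemma Const_mult_mono_of: "Const c * mono_of e = Poly_Mapping.single e c"
  by (simp add: mult_single)

lemma lookup_sum_Const_mono_of:
  assumes "finite E"
  shows "Poly_Mapping.lookup (\<Sum>e\<in>E. Const (c e) * mono_of e) x = (if x \<in> E then c x else 0)"
  using assms by (simp add: Const_mult_mono_of lookup_sum lookup_single when_def)

lemma mpoly_eq_sum_monomials:
  "f = (\<Sum>e\<in>Poly_Mapping.keys f. Const (Poly_Mapping.lookup f e) * mono_of e)"
  by (rule poly_mapping_eqI) (simp add: lookup_sum_Const_mono_of in_keys_iff)

lemma mem_monomial_ideal_iff:
  fixes f :: "('n, 'k::field) mpoly"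
  assumes up: "\<And>e d. e \<in> S \<Longrightarrow> e + d \<in> S"
  shows "f \<in> ideal_gen (mono_of ` S) \<longleftrightarrow> Poly_Mapping.keys f \<subseteq> S"
proof
  let ?T = "{f :: ('n, 'k) mpoly. Poly_Mapping.keys f \<subseteq> S}"
  have "is_ideal ?T"
  proof (rule Modules.module.subspaceI[OF module_mult])
    show "x + y \<in> ?T" if "x \<in> ?T" "y \<in> ?T" for x y
      using that Poly_Mapping.keys_add[of x y] by blast
    show "c * x \<in> ?T" if "x \<in> ?T" for c x
    proof -
      have "a + b \<in> S" if "b \<in> S" for a b using up[OF that, of a] by (simp add: add.commute)
      then show ?thesis using that keys_mult[of c x] by blast
    qed
  qed simp
  moreover have "mono_of ` S \<subseteq> ?T" by auto
  ultimately show "Poly_Mapping.keys f \<subseteq> S" if "f \<in> ideal_gen (mono_of ` S)"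
    using Modules.module.span_minimal[OF module_mult] that by blast
next
  assume keys: "Poly_Mapping.keys f \<subseteq> S"
  have ideal: "is_ideal (ideal_gen (mono_of ` S :: ('n, 'k) mpoly set))"
    by (rule Modules.module.subspace_span[OF module_mult])
  have "(\<Sum>e\<in>Poly_Mapping.keys f. Const (Poly_Mapping.lookup f e) * mono_of e) \<in> ideal_gen (mono_of ` S)"
  proof (rule ideal_sum[OF ideal], rule ideal_mult[OF ideal])
    fix e assume "e \<in> Poly_Mapping.keys f"
    then show "mono_of e \<in> ideal_gen (mono_of ` S :: ('n, 'k) mpoly set)"
      using keys by (intro Modules.module.span_base[OF module_mult]) auto
  qed
  then show "f \<in> ideal_gen (mono_of ` S)" using mpoly_eq_sum_monomials[of f] by simp
qed

text \<open>
  Finite order ideals of monomials. Their complements span exactly the monomial ideals of finite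
  colength, and the members of the staircase are then a basis of the quotient.
\<close>

locale finite_staircase =
  fixes E :: "('n::linorder \<Rightarrow>\<^sub>0 nat) set"
  assumes fin: "finite E" and up: "e \<notin> E \<Longrightarrow> e + d \<notin> E"
begin

definition complement_ideal :: "('n, 'k::field) mpoly set" where
  "complement_ideal = ideal_gen (mono_of ` (- E))"

lemma is_ideal_complement_ideal: "is_ideal complement_ideal"
  unfolding complement_ideal_def by (rule Modules.module.subspace_span[OF module_mult])

lemma mem_complement_ideal_iff: "f \<in> complement_ideal \<longleftrightarrow> (\<forall>e\<in>E. Poly_Mapping.lookup f e = 0)"
  unfolding complement_ideal_def
  by (subst mem_monomial_ideal_iff) (use up in \<open>auto simp: subset_iff in_keys_iff\<close>)

lemma mono_of_mem_complement_ideal_iff: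
  "(mono_of e :: ('n, 'k::field) mpoly) \<in> complement_ideal \<longleftrightarrow> e \<notin> E"
  by (auto simp: mem_complement_ideal_iff lookup_single when_def)

lemma squat_staircase_complement_ideal:
  "squat_staircase (complement_ideal :: ('n, 'k::field) mpoly set) = E"
  by (simp add: squat_staircase_def mono_of_mem_complement_ideal_iff)

lemma quotient_basis_complement_ideal:
  "quotient_basis (complement_ideal :: ('n, 'k::field) mpoly set) E mono_of"
  unfolding quotient_basis_def
proof (intro conjI allI impI ballI)
  fix f :: "('n, 'k) mpoly"
  show "\<exists>c. f - (\<Sum>e\<in>E. Const (c e) * mono_of e) \<in> complement_ideal"
    by (intro exI[of _ "Poly_Mapping.lookup f"])
      (simp add: mem_complement_ideal_iff lookup_minus lookup_sum_Const_mono_of[OF fin])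
next
  fix c :: "('n \<Rightarrow>\<^sub>0 nat) \<Rightarrow> 'k" and e
  assume "(\<Sum>e\<in>E. Const (c e) * mono_of e) \<in> complement_ideal" and e: "e \<in> E"
  then have "Poly_Mapping.lookup (\<Sum>e\<in>E. Const (c e) * mono_of e) e = 0"
    unfolding mem_complement_ideal_iff by blast
  then show "c e = 0" unfolding lookup_sum_Const_mono_of[OF fin] using e by simp
qed (rule fin)

lemma zero_dimensional_complement_ideal:
  "zero_dimensional (complement_ideal :: ('n, 'k::field) mpoly set)"
proof -
  obtain h where "bij_betw h {..<card E} E"
    using ex_bij_betw_nat_finite[OF fin] by (auto simp: atLeast0LessThan)
  from quotient_basis_complement_ideal[folded quotient_basis_reindex[OF this]] show ?thesis
    unfolding zero_dimensional_def has_colength_def using is_ideal_complement_ideal by blast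
qed

end

text \<open>
  Colon ideals are ideals, so membership has to be tested only on the generators of the two
  factors of the square.
\<close>

lemma vars_ideal_sq_mult_mem:
  fixes J :: "('n, 'k::field) mpoly set"
  assumes ideal: "is_ideal J" and p: "p \<in> vars_ideal_sq"
    and vars: "\<And>i j. Var i * Var j * f \<in> J"
  shows "p * f \<in> J"
proof -
  have colon: "is_ideal {p. p * g \<in> J}" for g
    by (rule Modules.module.subspaceI[OF module_mult])
      (auto simp: ideal_zero[OF ideal] ideal_add[OF ideal] ideal_mult[OF ideal] distrib_right mult.assoc)
  have span: "p * g \<in> J" if "p \<in> ideal_gen S" "\<And>x. x \<in> S \<Longrightarrow> x * g \<in> J" for p g S
    using Modules.module.span_minimal[OF module_mult _ colon[of g], of S] that by blast
  have 1: "q * (Var i * f) \<in> J" if "q \<in> vars_ideal" for q i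
    using that unfolding vars_ideal_def
  proof (rule span)
    show "x * (Var i * f) \<in> J" if "x \<in> range Var" for x
      using vars that by (auto simp: mult.assoc)
  qed
  have 2: "q * (q' * f) \<in> J" if "q \<in> vars_ideal" "q' \<in> vars_ideal" for q q'
    using that(1) unfolding vars_ideal_def
  proof (rule span)
    show "x * (q' * f) \<in> J" if "x \<in> range Var" for x
      using 1[OF \<open>q' \<in> vars_ideal\<close>] that by (auto simp: mult.left_commute)
  qed
  show ?thesis using p unfolding vars_ideal_sq_def
    by (rule span) (use 2 in \<open>auto simp: mult.assoc\<close>)
qed

lemma (in finite_staircase) squat_ideal_complement_ideal:
  assumes borel: "\<And>i j m. j < i \<Longrightarrow> Poly_Mapping.single i 1 + m \<notin> E \<Longrightarrow> Poly_Mapping.single j 1 + m \<notin> E"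
    and squat: "\<And>i j k m. Poly_Mapping.single i 1 + m \<notin> E \<Longrightarrow>
      Poly_Mapping.single j 1 + Poly_Mapping.single k 1 + m \<notin> E"
  shows "squat_ideal (complement_ideal :: ('n, 'k::field) mpoly set)"
  unfolding squat_ideal_def borel_fixed_def
proof (intro conjI allI impI ballI)
  let ?J = "complement_ideal :: ('n, 'k) mpoly set"
  show "monomial_ideal ?J" unfolding monomial_ideal_def complement_ideal_def by blast
  show "zero_dimensional ?J" by (rule zero_dimensional_complement_ideal)
  show "Var j * mono_of m \<in> ?J" if "j \<le> i" "Var i * mono_of m \<in> ?J" for i j m
    using that borel[of j i m]
    by (cases "j = i") (auto simp: mult_single mono_of_mem_complement_ideal_iff)
  show "p * mono_of m \<in> ?J" if "Var i * mono_of m \<in> ?J" "p \<in> vars_ideal_sq" for i m p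
    by (rule vars_ideal_sq_mult_mem[OF is_ideal_complement_ideal that(2)])
      (use that(1) squat in \<open>auto simp: mult_single mono_of_mem_complement_ideal_iff\<close>)
qed

text \<open>
  The monomials span, and finitely many of them suffice because finitely many basis elements
  have finitely many terms between them. A spanning set of least size is independent.
\<close>

lemma exists_monomial_quotient_basis:
  fixes I :: "('n, 'k::field) mpoly set"
  assumes ideal: "is_ideal I" and "has_colength I r"
  shows "\<exists>S. quotient_basis I S mono_of"
proof -
  define spans where "spans S \<longleftrightarrow> (\<forall>f. \<exists>c. f - (\<Sum>e\<in>S. Const (c e) * mono_of e) \<in> I)" for S
  obtain b where b: "quotient_basis I {..<r} b" using assms(2) by (auto simp: has_colength_def)
  define S0 where "S0 = (\<Union>k<r. Poly_Mapping.keys (b k))"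
  have fin0: "finite S0" by (simp add: S0_def)
  have "\<exists>c. f - (\<Sum>e\<in>S0. Const (c e) * mono_of e) \<in> I" for f
  proof -
    obtain c where c: "f - (\<Sum>k<r. Const (c k) * b k) \<in> I"
      using quotient_basis_spanning[OF b] by blast
    define g where "g = (\<Sum>k<r. Const (c k) * b k)"
    have "Poly_Mapping.lookup g e = 0" if "e \<notin> S0" for e
    proof -
      have "e \<notin> Poly_Mapping.keys (Const (c k) * b k)" if "k < r" for k
        using \<open>e \<notin> S0\<close> that keys_mult[of "Const (c k)" "b k"] by (auto simp: S0_def split: if_splits)
      then show ?thesis by (simp add: g_def lookup_sum in_keys_iff)
    qed
    then have "(\<Sum>e\<in>S0. Const (Poly_Mapping.lookup g e) * mono_of e) = g"
      by (intro poly_mapping_eqI) (auto simp: lookup_sum_Const_mono_of[OF fin0])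
    then have "f - (\<Sum>e\<in>S0. Const (Poly_Mapping.lookup g e) * mono_of e) \<in> I"
      using c unfolding g_def by (simp only:)
    then show ?thesis by (rule exI[of _ "Poly_Mapping.lookup g"])
  qed
  then have "finite S0 \<and> spans S0" using fin0 by (simp add: spans_def)
  then obtain S where S: "finite S" "spans S" and min: "\<And>T. finite T \<Longrightarrow> spans T \<Longrightarrow> card S \<le> card T"
    using ex_has_least_nat[of "\<lambda>S. finite S \<and> spans S" S0 card] by blast
  have "c e = 0" if rel: "(\<Sum>e\<in>S. Const (c e) * mono_of e) \<in> I" and e: "e \<in> S" for c e
  proof (rule ccontr)
    assume ce: "c e \<noteq> 0"
    have "\<exists>d. f - (\<Sum>x\<in>S - {e}. Const (d x) * mono_of x) \<in> I" for f
    proof -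
      obtain d where d: "f - (\<Sum>x\<in>S. Const (d x) * mono_of x) \<in> I"
        using S(2) unfolding spans_def by blast
      \<comment> \<open>Subtracting this multiple of the relation eliminates \<open>e\<close>.\<close>
      define q where "q = d e / c e"
      have "f - (\<Sum>x\<in>S. Const (d x) * mono_of x) + Const q * (\<Sum>x\<in>S. Const (c x) * mono_of x) \<in> I"
        by (intro ideal_add[OF ideal d] ideal_mult[OF ideal rel])
      also have "f - (\<Sum>x\<in>S. Const (d x) * mono_of x) + Const q * (\<Sum>x\<in>S. Const (c x) * mono_of x)
          = f - (\<Sum>x\<in>S. Const (d x - q * c x) * mono_of x)"
        unfolding sum_distrib_left mult.assoc[symmetric] Const_mult[symmetric]
        by (simp add: single_diff left_diff_distrib sum_subtractf)
      also have "(\<Sum>x\<in>S. Const (d x - q * c x) * mono_of x)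
          = (\<Sum>x\<in>S - {e}. Const (d x - q * c x) * mono_of x)"
        using S(1) e ce by (subst sum.remove[of S e]) (auto simp: q_def)
      finally show ?thesis by (rule exI[of _ "\<lambda>x. d x - q * c x"])
    qed
    then have "spans (S - {e})" by (simp add: spans_def)
    then have "card S \<le> card (S - {e})" using S(1) by (intro min) auto
    then show False using card_Diff1_less[OF S(1) e] by simp
  qed
  then have "quotient_basis I S mono_of"
    using S unfolding quotient_basis_def spans_def by blast
  then show ?thesis by blast
qed

section \<open>Bases of minimal rank\<close>

text \<open>
  A basis of monomials in \<open>v\<close> whose total rank is least, where the point \<open>v\<close> may vary
  together with the exponents. Minimality over all points replaces genericity of \<open>v\<close>: at such
  a point every rank condition on the monomials takes its generic value, and no other point can
  do better.
\<close>

locale minimal_monomial_basis =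
  fixes I :: "('n::{finite,linorder}, 'k::field) mpoly set"
    and s :: nat
    and v :: "'n \<Rightarrow> ('n, 'k) mpoly"
    and h :: "nat \<Rightarrow> 'n \<Rightarrow>\<^sub>0 nat"
  assumes ideal: "is_ideal I"
    and basis: "quotient_basis I {..<s} (\<lambda>k. monomial_at v (h k))"
    and minimal: "\<And>(v' :: 'n \<Rightarrow> ('n, 'k) mpoly) h'. quotient_basis I {..<s} (\<lambda>k. monomial_at v' (h' k)) \<Longrightarrow>
      (\<Sum>k<s. deglex_rank (h k)) \<le> (\<Sum>k<s. deglex_rank (h' k))"
begin

sublocale quotient_coordinates I s "\<lambda>k. monomial_at v (h k)"
  by unfold_locales (rule ideal, rule basis)

abbreviation cd :: "('n, 'k) mpoly \<Rightarrow> nat \<Rightarrow> 'k" where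
  "cd \<equiv> coord I s (\<lambda>k. monomial_at v (h k))"

text \<open>
  If an exponent \<open>h l\<close> of larger rank occurred in the expansion of the monomial \<open>e\<close>, then
  exchanging \<open>h l\<close> for \<open>e\<close> would lower the total rank. The statement
  is about an arbitrary point \<open>v'\<close> so that it applies along deformations of \<open>v\<close>.
\<close>

lemma rank_le_if_coord_nonzero:
  assumes basis': "quotient_basis I {..<s} (\<lambda>k. monomial_at v' (h k))"
    and "l < s" and "coord I s (\<lambda>k. monomial_at v' (h k)) (monomial_at v' e) l \<noteq> 0"
  shows "deglex_rank (h l) \<le> deglex_rank e"
proof -
  interpret B: quotient_coordinates I s "\<lambda>k. monomial_at v' (h k)"
    by unfold_locales (rule ideal, rule basis')
  have "(\<lambda>k. monomial_at v' (h k))(l := monomial_at v' e) = (\<lambda>k. monomial_at v' ((h(l := e)) k))"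
    by auto
  with B.quotient_basis_exchange[OF assms(2,3)]
  have "quotient_basis I {..<s} (\<lambda>k. monomial_at v' ((h(l := e)) k))" by simp
  from minimal[OF this] show ?thesis
    using \<open>l < s\<close> by (simp add: sum.remove[of _ l])
qed

lemmas greedy = rank_le_if_coord_nonzero[OF basis]

definition staircase :: "('n \<Rightarrow>\<^sub>0 nat) set" where
  "staircase = h ` {..<s}"

lemma bij_betw_staircase: "bij_betw h {..<s} staircase"
proof -
  have "inj_on h {..<s}"
    using quotient_basis_inj_on[OF ideal basis] by (auto simp: inj_on_def)
  then show ?thesis by (simp add: bij_betw_def staircase_def)
qed

text \<open>
  A monomial outside the staircase is a combination of strictly smaller members of it. Multiplying
  the relation by the monomial \<open>d\<close> keeps it strict, so the product is a combination of smaller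
  monomials as well, and cannot be a basis element.
\<close>

lemma staircase_complement_up:
  assumes "e \<notin> staircase"
  shows "e + d \<notin> staircase"
proof
  assume "e + d \<in> staircase"
  then obtain k where k: "k < s" "h k = e + d" by (auto simp: staircase_def)
  have zero: "cd (monomial_at v e) l * cd (monomial_at v (h l + d)) k = 0" if "l < s" for l
  proof (rule ccontr)
    assume "\<not> ?thesis"
    then have "cd (monomial_at v e) l \<noteq> 0" "cd (monomial_at v (h l + d)) k \<noteq> 0" by simp_all
    then have "deglex_rank (h l) \<le> deglex_rank e" "deglex_rank (e + d) \<le> deglex_rank (h l + d)"
      using greedy[OF that] greedy[OF k(1)] k(2) by simp_all
    then have "deglex_rank (h l) = deglex_rank e"
      using deglex_rank_add_less_iff[of "h l" d e] by linarith
    then show False using assms that by (auto simp: deglex_rank_eq_iff staircase_def)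
  qed
  have "cd (monomial_at v (h k)) k
      = (\<Sum>l<s. cd (monomial_at v e) l * cd (monomial_at v (h l + d)) k)"
    unfolding k(2) monomial_at_add by (rule coord_mult[OF k(1)])
  also have "\<dots> = 0" by (rule sum.neutral) (use zero in blast)
  finally have "cd (monomial_at v (h k)) k = 0" .
  then show False using coord_basis[OF k(1) k(1)] by simp
qed

end

section \<open>First-order deformations\<close>

lemma poly_map_poly_linear:
  fixes L :: "('n, 'k::field) mpoly \<Rightarrow> 'k"
  assumes add: "\<And>f g. L (f + g) = L f + L g" and scale: "\<And>a f. L (Const a * f) = a * L f"
  shows "poly (map_poly L F) t = L (poly F (Const t))"
proof -
  have "L 0 = 0" using scale[of 0 0] by simp
  then show ?thesis
    by (induction F) (simp_all add: map_poly_pCons add scale)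
qed

lemma poly_monomial_at: "poly (monomial_at V e) x = monomial_at (\<lambda>j. poly (V j) x) e"
  by (simp add: monomial_at_def poly_prod)

lemma coeff_mult_1:
  "coeff (p * q) (Suc 0) = coeff p 0 * coeff q (Suc 0) + coeff p (Suc 0) * coeff q 0"
  by (simp add: coeff_mult)

lemma coeff_linear_power:
  fixes a b :: "'a::comm_ring_1"
  shows "coeff ([:a, b:] ^ n) 0 = a ^ n"
    and "coeff ([:a, b:] ^ n) (Suc 0) = of_nat n * a ^ (n - 1) * b"
proof -
  show 0: "coeff ([:a, b:] ^ n) 0 = a ^ n" for n by (simp add: coeff_0_power)
  show "coeff ([:a, b:] ^ n) (Suc 0) = of_nat n * a ^ (n - 1) * b"
  proof (induction n)
    case (Suc n)
    have "coeff ([:a, b:] ^ Suc n) (Suc 0) = a * coeff ([:a, b:] ^ n) (Suc 0) + b * a ^ n"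
      unfolding power_Suc coeff_mult_1 0 by simp
    also have "\<dots> = of_nat (Suc n) * a ^ n * b"
      unfolding Suc.IH by (cases n) (simp_all add: algebra_simps)
    finally show ?case by simp
  qed simp
qed

lemma prod_const_poly: "(\<Prod>j\<in>A. [:g j:]) = [:\<Prod>j\<in>A. g j:]"
  by (induction A rule: infinite_finite_induct) (auto simp: mult.commute)

text \<open>
  The product rule to first order, for the path that moves only the \<open>i\<close>-th component of
  \<open>v\<close>, in direction \<open>q\<close>. The truncated exponent is harmless, since the scalar factor vanishes
  when \<open>e\<close> does not involve \<open>i\<close>.
\<close>

lemma coeff_monomial_at_deformed:
  fixes v :: "'n::finite \<Rightarrow> 'a::comm_ring_1" and i :: 'n and q :: 'a
  defines "V \<equiv> \<lambda>j. if j = i then [:v i, q:] else [:v j:]"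
  shows "coeff (monomial_at V e) 0 = monomial_at v e"
    and "coeff (monomial_at V e) (Suc 0) =
      of_nat (Poly_Mapping.lookup e i) * monomial_at v (e - Poly_Mapping.single i 1) * q"
proof -
  define c where "c = (\<Prod>j\<in>UNIV - {i}. v j ^ Poly_Mapping.lookup e j)"
  have V: "monomial_at V e = Polynomial.smult c ([:v i, q:] ^ Poly_Mapping.lookup e i)"
  proof -
    have "monomial_at V e = [:v i, q:] ^ Poly_Mapping.lookup e i *
        (\<Prod>j\<in>UNIV - {i}. V j ^ Poly_Mapping.lookup e j)"
      unfolding monomial_at_def by (subst prod.remove[of _ i]) (auto simp: V_def)
    also have "(\<Prod>j\<in>UNIV - {i}. V j ^ Poly_Mapping.lookup e j) = [:c:]"
      unfolding c_def prod_const_poly[symmetric]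
      by (intro prod.cong) (auto simp: V_def poly_const_pow)
    finally show ?thesis by simp
  qed
  have "monomial_at v e = v i ^ Poly_Mapping.lookup e i * c"
    unfolding monomial_at_def c_def by (rule prod.remove) auto
  then show "coeff (monomial_at V e) 0 = monomial_at v e"
    by (simp add: V coeff_linear_power mult.commute)
  have "monomial_at v (e - Poly_Mapping.single i 1) = v i ^ (Poly_Mapping.lookup e i - 1) * c"
    unfolding monomial_at_def c_def
    by (subst prod.remove[of _ i]) (auto simp: lookup_minus lookup_single when_def intro!: prod.cong)
  then show "coeff (monomial_at V e) (Suc 0) =
      of_nat (Poly_Mapping.lookup e i) * monomial_at v (e - Poly_Mapping.single i 1) * q"
    by (simp add: V coeff_linear_power(2) mult_ac)
qed

text \<open>
  Both the Borel and the squat condition are instances of this one: from \<open>x_i m\<close> outside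
  the staircase, it concludes that \<open>p m\<close> is outside for every monomial \<open>p\<close> above \<open>x_i\<close>.

  Move \<open>v_i\<close> to \<open>v_i + t v^p\<close>. The staircase remains a basis for almost all \<open>t\<close>, and Cramer's
  rule gives, for \<open>e = x_i m\<close>, a polynomial identity in \<open>t\<close>
  \<open>D(t) v(t)^e = \<Sum>g. N_g(t) v(t)^g\<close> with \<open>D(0) \<noteq> 0\<close>,
  in which \<open>N_g\<close> vanishes identically for \<open>g\<close> above \<open>e\<close>, by minimality at all points of the path.
  The derivative of the left side at \<open>t = 0\<close> contains \<open>D(0) a v^{pm}\<close>, where \<open>a\<close> is the
  exponent of \<open>x_i\<close> in \<open>e\<close>, nonzero in characteristic zero. All the other terms are multiples of
  \<open>v^g\<close> with \<open>g\<close> at most \<open>e\<close>, or of \<open>v^{g p / x_i}\<close> with \<open>g\<close> below \<open>e\<close>, and these exponents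
  are all below \<open>p m\<close>. Hence \<open>v^{pm}\<close> is a combination of smaller monomials. In the proof, \<open>k\<close>
  is the supposed index of \<open>p m\<close> in the basis, and the derivative is compared in the \<open>k\<close>-th
  coordinate, where every term but one is zero.
\<close>

lemma staircase_complement_step:
  fixes I :: "('n::{finite,linorder}, 'k::field_char_0) mpoly set"
  assumes "minimal_monomial_basis I s v h"
    and xp: "deglex_rank (Poly_Mapping.single i 1) < deglex_rank p"
    and notin: "Poly_Mapping.single i 1 + m \<notin> h ` {..<s}"
  shows "p + m \<notin> h ` {..<s}"
proof
  interpret minimal_monomial_basis I s v h by fact
  let ?x = "Poly_Mapping.single i (1::nat)"
  define e where "e = ?x + m"
  assume "p + m \<in> h ` {..<s}"
  then obtain k where k: "k < s" "h k = p + m" by auto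
  have ek: "deglex_rank e < deglex_rank (h k)"
    unfolding e_def k(2) using xp by (simp only: deglex_rank_add_less_iff)
  define V where "V = (\<lambda>j. if j = i then [:v i, monomial_at v p:] else [:v j:])"
  define w where "w t j = poly (V j) (Const t)" for t j
  \<comment> \<open>the \<open>k\<close>-th coordinate of the monomial \<open>f\<close> along the path, as a polynomial in \<open>t\<close>\<close>
  define Q where "Q f k = map_poly (\<lambda>x. cd x k) (monomial_at V f)" for f k
  have w0: "w 0 = v" by (auto simp: w_def V_def)
  have coeff_Q: "coeff (Q f k) n = cd (coeff (monomial_at V f) n) k" if "k < s" for f k n
    unfolding Q_def by (rule coeff_map_poly) (rule coord_zero[OF that])
  have poly_Q: "poly (Q f k) t = cd (monomial_at (w t) f) k" if "k < s" for f k t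
    unfolding Q_def w_def poly_monomial_at[symmetric]
    by (rule poly_map_poly_linear) (simp_all add: coord_add coord_scale that)
  define M where "M = mat s s (\<lambda>(k, l). Q (h l) k)"
  \<comment> \<open>\<open>D\<close> times the coordinates of the monomial \<open>e\<close> along the path; dividing by \<open>D\<close> is avoided\<close>
  define N where "N = adj_mat M *\<^sub>v vec s (Q e)"
  define D where "D = det M"
  have M: "M \<in> carrier_mat s s" by (simp add: M_def)
  have N: "N \<in> carrier_vec s" using adj_mat(1)[OF M] by (simp add: N_def)
  have cramer: "(\<Sum>l<s. Q (h l) k * N $ l) = D * Q e k" if "k < s" for k
  proof -
    have "M *\<^sub>v N = D \<cdot>\<^sub>m 1\<^sub>m s *\<^sub>v vec s (Q e)"
      unfolding N_def D_def adj_mat(2)[OF M, symmetric]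
      by (rule assoc_mult_mat_vec[symmetric, OF M adj_mat(1)[OF M]]) simp
    then have "(M *\<^sub>v N) $ k = (\<Sum>l<s. (if l = k then D else 0) * Q e l)"
      using that by (auto simp: scalar_prod_def atLeast0LessThan intro!: sum.cong)
    also have "\<dots> = (\<Sum>l<s. if l = k then D * Q e l else 0)"
      by (intro sum.cong) auto
    also have "\<dots> = D * Q e k" using that by simp
    finally have "(M *\<^sub>v N) $ k = D * Q e k" .
    then show ?thesis using that N by (simp add: M_def scalar_prod_def atLeast0LessThan)
  qed
  have poly_D: "poly D t = det (coord_mat (\<lambda>l. monomial_at (w t) (h l)))" for t
  proof -
    interpret ev: comm_ring_hom "\<lambda>p. poly p t" by unfold_locales auto
    have "map_mat (\<lambda>p. poly p t) M = coord_mat (\<lambda>l. monomial_at (w t) (h l))"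
      by (rule eq_matI) (auto simp: M_def coord_mat_def poly_Q)
    then show ?thesis unfolding D_def ev.hom_det[symmetric] by simp
  qed
  have D0: "coeff D 0 \<noteq> 0"
    using basis unfolding quotient_basis_iff_det_nonzero poly_0_coeff_0[symmetric] poly_D w0 .
  have N_zero: "N $ l = 0" if "l < s" "deglex_rank e < deglex_rank (h l)" for l
  proof (rule ccontr)
    assume "N $ l \<noteq> 0"
    moreover have "D \<noteq> 0" using D0 by auto
    ultimately have "N $ l * D \<noteq> 0" by simp
    \<comment> \<open>the ground field is infinite\<close>
    then obtain t where t: "poly (N $ l) t \<noteq> 0" "poly D t \<noteq> 0"
      using poly_all_0_iff_0[of "N $ l * D"] by auto
    have basis': "quotient_basis I {..<s} (\<lambda>l. monomial_at (w t) (h l))"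
      using t(2) by (simp add: quotient_basis_iff_det_nonzero poly_D)
    interpret B: quotient_coordinates I s "\<lambda>l. monomial_at (w t) (h l)"
      by unfold_locales (rule ideal, rule basis')
    let ?c = "\<lambda>l. poly (N $ l) t / poly D t"
    let ?S = "\<Sum>l<s. Const (?c l) * monomial_at (w t) (h l)"
    have "cd (monomial_at (w t) e - ?S) j = 0" if "j < s" for j
    proof -
      have "poly D t * cd (monomial_at (w t) e) j = (\<Sum>l<s. cd (monomial_at (w t) (h l)) j * poly (N $ l) t)"
        using arg_cong[OF cramer[OF that], of "\<lambda>p. poly p t"] by (simp add: poly_sum poly_Q that)
      then have "cd (monomial_at (w t) e) j = (\<Sum>l<s. cd (monomial_at (w t) (h l)) j * poly (N $ l) t) / poly D t"
        using t(2) by (metis nonzero_mult_div_cancel_left)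
      also have "\<dots> = cd ?S j"
        unfolding coord_sum[OF that] coord_scale[OF that] sum_divide_distrib
        by (intro sum.cong) auto
      finally show ?thesis
        using coord_add[OF that, of "monomial_at (w t) e - ?S" ?S] by simp
    qed
    then have "monomial_at (w t) e - ?S \<in> I" by (simp add: in_ideal_iff_coord)
    from B.coord_eqI[OF this \<open>l < s\<close>]
    have "coord I s (\<lambda>l. monomial_at (w t) (h l)) (monomial_at (w t) e) l \<noteq> 0" using t by simp
    from rank_le_if_coord_nonzero[OF basis' \<open>l < s\<close> this] that(2) show False by simp
  qed
  have coeff0: "coeff (monomial_at V f) 0 = monomial_at v f"
    and coeff1: "coeff (monomial_at V f) (Suc 0) =
      of_nat (Poly_Mapping.lookup f i) * monomial_at v (f - ?x) * monomial_at v p" for f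
    unfolding V_def by (rule coeff_monomial_at_deformed)+
  have coeff_Q1: "coeff (Q f k) (Suc 0) =
      of_nat (Poly_Mapping.lookup f i) * cd (monomial_at v (p + (f - ?x))) k" for f
  proof -
    have "of_nat (Poly_Mapping.lookup f i) * monomial_at v (f - ?x) * monomial_at v p
        = Const (of_nat (Poly_Mapping.lookup f i)) * monomial_at v (p + (f - ?x))"
      by (simp only: monomial_at_add single_of_nat mult.assoc mult.commute[of "monomial_at v p"])
    then show ?thesis unfolding coeff_Q[OF k(1)] coeff1 by (simp only: coord_scale[OF k(1)])
  qed
  \<comment> \<open>Cramer's identity is compared in degree 1; every summand of its right side contributes zero.\<close>
  have vanish: "coeff (Q (h l) k * N $ l) (Suc 0) = 0" if l: "l < s" for l
  proof (cases "deglex_rank e < deglex_rank (h l)")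
    case True
    then show ?thesis using N_zero l by simp
  next
    case False
    have "h l \<noteq> e" using notin l unfolding e_def by (metis image_eqI lessThan_iff)
    then have le: "deglex_rank (h l) < deglex_rank e"
      using False deglex_rank_eq_iff[of "h l" e] by linarith
    have "coeff (Q (h l) k) 0 = 0"
      using le ek coord_basis[OF l k(1)] by (auto simp: coeff_Q[OF k(1)] coeff0)
    moreover have "coeff (Q (h l) k) (Suc 0) = 0"
    proof (cases "Poly_Mapping.lookup (h l) i = 0")
      case False
      define f where "f = h l - ?x"
      have f: "h l = ?x + f"
        using False by (intro poly_mapping_eqI) (auto simp: f_def lookup_add lookup_minus lookup_single when_def)
      have "deglex_rank (f + ?x) < deglex_rank (m + ?x)"
        using le unfolding f e_def by (simp only: add.commute)
      then have "deglex_rank (f + p) < deglex_rank (m + p)"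
        by (simp only: deglex_rank_add_less_iff)
      then have "\<not> deglex_rank (h k) \<le> deglex_rank (p + f)"
        by (simp add: k(2) add.commute)
      then have "cd (monomial_at v (p + f)) k = 0" using greedy[OF k(1)] by blast
      then show ?thesis by (simp add: coeff_Q1 f_def)
    qed (simp add: coeff_Q1)
    ultimately show ?thesis by (simp add: coeff_mult_1)
  qed
  have "cd (monomial_at v e) k = 0" using greedy[OF k(1)] ek by force
  then have "coeff (D * Q e k) (Suc 0) = coeff D 0 * coeff (Q e k) (Suc 0)"
    by (simp add: coeff_mult_1 coeff_Q[OF k(1)] coeff0)
  also have "coeff (Q e k) (Suc 0) = of_nat (Suc (Poly_Mapping.lookup m i)) * cd (monomial_at v (h k)) k"
    unfolding coeff_Q1 by (simp add: e_def k(2) lookup_add lookup_single)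
  also have "cd (monomial_at v (h k)) k = 1" using coord_basis[OF k(1) k(1)] by simp
  finally have "coeff (D * Q e k) (Suc 0) \<noteq> 0"
    using D0 of_nat_neq_0 by (simp del: of_nat_Suc)
  moreover have "coeff (D * Q e k) (Suc 0) = 0"
    unfolding cramer[OF k(1), symmetric] coeff_sum using vanish by (intro sum.neutral) auto
  ultimately show False by simp
qed

section \<open>Regular functions\<close>

text \<open>
  Regularity is tracked on tuples of polynomials, which can be multiplied directly, and
  not on tuples of residue classes.
\<close>

definition regular_in_classes ::
    "('n, 'k::field) mpoly set \<Rightarrow> (('n \<Rightarrow> ('n, 'k) mpoly) \<Rightarrow> 'k) \<Rightarrow> bool" where
  "regular_in_classes I \<phi> \<longleftrightarrow>
     (\<exists>G\<in>regular_functions I. \<forall>v. G (\<lambda>i. residue_class I (v i)) = \<phi> v)"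

lemma regular_in_classes_const: "regular_in_classes I (\<lambda>_. c)"
  unfolding regular_in_classes_def by (rule bexI[OF _ regular_functions.const]) simp

lemma regular_in_classes_add:
  assumes "regular_in_classes I \<phi>" "regular_in_classes I \<psi>"
  shows "regular_in_classes I (\<lambda>v. \<phi> v + \<psi> v)"
proof -
  obtain F G where "F \<in> regular_functions I" "G \<in> regular_functions I"
    and "\<And>v. F (\<lambda>i. residue_class I (v i)) = \<phi> v" "\<And>v. G (\<lambda>i. residue_class I (v i)) = \<psi> v"
    using assms unfolding regular_in_classes_def by blast
  then show ?thesis
    unfolding regular_in_classes_def by (intro bexI[OF _ regular_functions.add[of F I G]]) simp_all
qed

lemma regular_in_classes_mult:
  assumes "regular_in_classes I \<phi>" "regular_in_classes I \<psi>"
  shows "regular_in_classes I (\<lambda>v. \<phi> v * \<psi> v)"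
proof -
  obtain F G where "F \<in> regular_functions I" "G \<in> regular_functions I"
    and "\<And>v. F (\<lambda>i. residue_class I (v i)) = \<phi> v" "\<And>v. G (\<lambda>i. residue_class I (v i)) = \<psi> v"
    using assms unfolding regular_in_classes_def by blast
  then show ?thesis
    unfolding regular_in_classes_def by (intro bexI[OF _ regular_functions.mult[of F I G]]) simp_all
qed

lemma regular_in_classes_sum:
  assumes "\<And>x. x \<in> A \<Longrightarrow> regular_in_classes I (\<lambda>v. \<phi> x v)"
  shows "regular_in_classes I (\<lambda>v. \<Sum>x\<in>A. \<phi> x v)"
  using assms
  by (induction A rule: infinite_finite_induct)
    (auto intro: regular_in_classes_const regular_in_classes_add)

lemma regular_in_classes_prod:
  assumes "\<And>x. x \<in> A \<Longrightarrow> regular_in_classes I (\<lambda>v. \<phi> x v)"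
  shows "regular_in_classes I (\<lambda>v. \<Prod>x\<in>A. \<phi> x v)"
  using assms
  by (induction A rule: infinite_finite_induct)
    (auto intro: regular_in_classes_const regular_in_classes_mult)

context quotient_coordinates
begin

text \<open>
  The coordinate of an arbitrarily chosen representative is a linear functional on the quotient,
  because coordinates do not change modulo \<open>I\<close>.
\<close>

lemma regular_coord_projection:
  assumes k: "k < s"
  shows "regular_in_classes I (\<lambda>v. coord I s b (v i) k)"
proof -
  define l where "l X = coord I s b (SOME f. residue_class I f = X) k" for X
  have l: "l (residue_class I f) = coord I s b f k" for f
  proof -
    have "residue_class I (SOME g. residue_class I g = residue_class I f) = residue_class I f"
      by (rule someI) (rule refl)
    then show ?thesis
      unfolding l_def residue_class_eq_iff[OF ideal] by (rule coord_cong[OF _ k])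
  qed
  have "linear_functional I l"
    unfolding linear_functional_def l by (simp add: coord_add[OF k] coord_scale[OF k])
  from regular_functions.linear[OF this] show ?thesis
    unfolding regular_in_classes_def by (intro bexI[where x = "\<lambda>w. l (w i)"]) (simp_all add: l)
qed

lemma regular_coord_mult:
  assumes "\<And>k. k < s \<Longrightarrow> regular_in_classes I (\<lambda>v. coord I s b (F v) k)"
    and "\<And>k. k < s \<Longrightarrow> regular_in_classes I (\<lambda>v. coord I s b (G v) k)"
    and k: "k < s"
  shows "regular_in_classes I (\<lambda>v. coord I s b (F v * G v) k)"
proof -
  have "coord I s b (F v * G v) k
      = (\<Sum>j<s. coord I s b (F v) j * (\<Sum>l<s. coord I s b (G v) l * coord I s b (b l * b j) k))" for v
    unfolding coord_mult[OF k, of "F v"]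
    by (intro sum.cong refl arg_cong2[of _ _ _ _ "(*)"])
      (simp only: mult.commute[of "b _" "G v"] coord_mult[OF k, of "G v"])
  then show ?thesis
    using assms
    by (auto intro!: regular_in_classes_sum regular_in_classes_mult regular_in_classes_const)
qed

lemma regular_coord_power:
  assumes "\<And>k. k < s \<Longrightarrow> regular_in_classes I (\<lambda>v. coord I s b (F v) k)" and "k < s"
  shows "regular_in_classes I (\<lambda>v. coord I s b (F v ^ n) k)"
  using assms(2)
proof (induction n arbitrary: k)
  case (Suc n)
  show ?case unfolding power_Suc by (rule regular_coord_mult[OF assms(1) Suc.IH Suc.prems])
qed (simp add: regular_in_classes_const)

lemma regular_coord_prod:
  assumes "\<And>x k. x \<in> A \<Longrightarrow> k < s \<Longrightarrow> regular_in_classes I (\<lambda>v. coord I s b (F x v) k)" and "k < s"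
  shows "regular_in_classes I (\<lambda>v. coord I s b (\<Prod>x\<in>A. F x v) k)"
  using assms
proof (induction A arbitrary: k rule: infinite_finite_induct)
  case (insert x A)
  have "regular_in_classes I (\<lambda>v. coord I s b (F x v * (\<Prod>x\<in>A. F x v)) k)"
    by (rule regular_coord_mult) (use insert in auto)
  then show ?case using insert(1,2) by simp
qed (simp_all add: regular_in_classes_const)

lemma regular_det_coord_mat:
  assumes "\<And>j k. j < s \<Longrightarrow> k < s \<Longrightarrow> regular_in_classes I (\<lambda>v. coord I s b (F v j) k)"
  shows "regular_in_classes I (\<lambda>v. det (coord_mat (F v)))"
  unfolding det_def'[OF coord_mat_carrier]
proof (intro regular_in_classes_sum regular_in_classes_mult regular_in_classes_const
    regular_in_classes_prod)
  fix p i assume "p \<in> {p. p permutes {0..<s}}" "i \<in> {0..<s}"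
  then have "i < s" "p i < s" using permutes_in_image[of p "{0..<s}" i] by auto
  then show "regular_in_classes I (\<lambda>v. coord_mat (F v) $$ (i, p i))"
    using assms by (simp add: coord_mat_def)
qed

end

lemma regular_coord_monomial_at:
  fixes I :: "('n::finite, 'k::field) mpoly set"
  assumes "quotient_coordinates I s b" "k < s"
  shows "regular_in_classes I (\<lambda>v. coord I s b (monomial_at v e) k)"
proof -
  interpret quotient_coordinates I s b by fact
  show ?thesis
    unfolding monomial_at_def using assms(2)
    by (intro regular_coord_prod regular_coord_power regular_coord_projection)
qed

lemma zariski_open_nonvanishing:
  assumes "G \<in> regular_functions I"
  shows "zariski_open I {w \<in> affine_pts I. G w \<noteq> 0}"
proof -
  have "affine_pts I - {w \<in> affine_pts I. G w \<noteq> 0} = {w \<in> affine_pts I. \<forall>f\<in>{G}. f w = 0}"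
    by auto
  then show ?thesis unfolding zariski_open_def zariski_closed_def using assms by blast
qed

section \<open>The squat staircase of a general tuple\<close>

theorem corollary7p11:
  fixes I :: "('n::{finite,linorder}, 'k::{alg_closed_field,field_char_0}) mpoly set"
    and r :: nat
  assumes "zero_dimensional I"
    and "has_colength I r"
  shows "\<exists>U. zariski_open I U \<and> U \<noteq> {} \<and>
           (\<forall>w\<in>U. \<forall>v :: 'n \<Rightarrow> ('n, 'k) mpoly.
              (\<forall>i. residue_class I (v i) = w i) \<longrightarrow>
              (\<exists>I0 :: ('n, 'k) mpoly set. squat_ideal I0 \<and>
                 quotient_basis I (squat_staircase I0)
                   (\<lambda>e. \<Prod>i\<in>UNIV. v i ^ Poly_Mapping.lookup e i)))"
proof -
  have ideal: "is_ideal I" using assms(1) by (simp add: zero_dimensional_def)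
  obtain S where S: "quotient_basis I S mono_of"
    using exists_monomial_quotient_basis[OF ideal assms(2)] by blast
  then have finS: "finite S" by (simp add: quotient_basis_def)
  define s where "s = card S"
  obtain h0 where h0: "bij_betw h0 {..<s} S"
    using ex_bij_betw_nat_finite[OF finS] by (auto simp: s_def atLeast0LessThan)
  \<comment> \<open>Point and exponents are minimised together; the variables themselves provide a start.\<close>
  define P where "P = (\<lambda>(v :: 'n \<Rightarrow> ('n, 'k) mpoly, h). quotient_basis I {..<s} (\<lambda>k. monomial_at v (h k)))"
  have "P (Var, h0)"
    using S quotient_basis_reindex[OF h0, of I mono_of]
    by (simp add: P_def monomial_at_Var del: One_nat_def)
  then obtain vh where vh: "P vh"
      "\<And>vh'. P vh' \<Longrightarrow> (\<Sum>k<s. deglex_rank (snd vh k)) \<le> (\<Sum>k<s. deglex_rank (snd vh' k))"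
    using ex_has_least_nat[of P "(Var, h0)" "\<lambda>vh. \<Sum>k<s. deglex_rank (snd vh k)"] by blast
  obtain v h where vh_eq: "vh = (v, h)" by (cases vh)
  interpret minimal_monomial_basis I s v h
  proof
    show "quotient_basis I {..<s} (\<lambda>k. monomial_at v (h k))"
      using vh(1) by (simp add: P_def vh_eq)
    show "(\<Sum>k<s. deglex_rank (h k)) \<le> (\<Sum>k<s. deglex_rank (h' k))"
      if "quotient_basis I {..<s} (\<lambda>k. monomial_at v' (h' k))"
      for v' :: "'n \<Rightarrow> ('n, 'k) mpoly" and h'
      using vh(2)[of "(v', h')"] that by (simp add: P_def vh_eq)
  qed (rule ideal)
  have step: "p + m \<notin> staircase"
    if "Poly_Mapping.single i 1 + m \<notin> staircase"
      "deglex_rank (Poly_Mapping.single i 1) < deglex_rank p" for i m p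
    using staircase_complement_step[OF minimal_monomial_basis_axioms that(2) that(1)[unfolded staircase_def]]
    by (simp only: staircase_def not_False_eq_True)
  interpret finite_staircase staircase
    by unfold_locales (simp add: staircase_def, rule staircase_complement_up)
  have squat: "squat_ideal (complement_ideal :: ('n, 'k) mpoly set)"
  proof (rule squat_ideal_complement_ideal)
    show "Poly_Mapping.single j 1 + m \<notin> staircase"
      if "j < i" "Poly_Mapping.single i 1 + m \<notin> staircase" for i j m
      by (rule step[OF that(2) deglex_rank_Var_less_Var[OF that(1)]])
    show "Poly_Mapping.single j 1 + Poly_Mapping.single k 1 + m \<notin> staircase"
      if "Poly_Mapping.single i 1 + m \<notin> staircase" for i j k m
      by (rule step[OF that deglex_rank_Var_less_quadratic])
  qed
  have "regular_in_classes I (\<lambda>v'. det (coord_mat (\<lambda>k. monomial_at v' (h k))))"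
    by (intro regular_det_coord_mat regular_coord_monomial_at quotient_coordinates_axioms)
  then obtain G where G: "G \<in> regular_functions I"
      "\<And>v'. G (\<lambda>i. residue_class I (v' i)) = det (coord_mat (\<lambda>k. monomial_at v' (h k)))"
    unfolding regular_in_classes_def by blast
  have G_iff: "G (\<lambda>i. residue_class I (v' i)) \<noteq> 0 \<longleftrightarrow> quotient_basis I staircase (monomial_at v')" for v'
    unfolding G(2) quotient_basis_iff_det_nonzero[symmetric]
    by (rule quotient_basis_reindex[OF bij_betw_staircase])
  define U where "U = {w \<in> affine_pts I. G w \<noteq> 0}"
  show ?thesis
  proof (intro exI[of _ U] conjI ballI allI impI)
    show "zariski_open I U" unfolding U_def by (rule zariski_open_nonvanishing[OF G(1)])
    have "(\<lambda>i. residue_class I (v i)) \<in> U"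
      using basis quotient_basis_reindex[OF bij_betw_staircase, of I "monomial_at v"]
      by (simp add: U_def affine_pts_def residue_ring_def G_iff)
    then show "U \<noteq> {}" by blast
  next
    fix w and v' :: "'n \<Rightarrow> ('n, 'k) mpoly"
    assume w: "w \<in> U" "\<forall>i. residue_class I (v' i) = w i"
    have w_eq: "w = (\<lambda>i. residue_class I (v' i))" using w(2) by auto
    have "G w \<noteq> 0" using w(1) by (simp add: U_def)
    then have "quotient_basis I staircase (monomial_at v')" unfolding w_eq G_iff .
    then show "\<exists>I0 :: ('n, 'k) mpoly set. squat_ideal I0 \<and>
        quotient_basis I (squat_staircase I0) (\<lambda>e. \<Prod>i\<in>UNIV. v' i ^ Poly_Mapping.lookup e i)"
      using squat
      by (intro exI[of _ complement_ideal])
        (simp add: squat_staircase_complement_ideal monomial_at_def[abs_def])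
  qed
qed

end
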